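(* The group $\mathbb{Z}*\mathbb{Z}^2=\langle t,a,b \mid ab=ba\rangle$ is not hyperbolic, but there exists a finite generating set $S$ of it (closed under inversion and not containing the identity) such that, with respect to $S$, for all $g\in(\mathbb{Z}*\mathbb{Z}^2)\setminus\{1\}$ we have $\kappa(g)<0$.
   Context: For a group $G$ with finite generating set $S$ (closed under inversion, not containing the identity), $|g|$ is the word length of $g$ with respect to $S$ and $d(g,h)=|h^{-1}g|$ is the word metric. For $g\neq 1$, the (1-spherical) conjugation curvature is $$\kappa(g)=\frac{|g|-\frac{1}{|S|}\sum_{s\in S}|s^{-1}gs|}{|g|}.$$ A finitely generated group is hyperbolic (in the sense of Gromov) if with its word metric it is $\delta$-hyperbolic for some $\delta\ge 0$, i.e. $(x,y)_w\geq \min\{(x,z)_w,(y,z)_w\}-\delta$ for all points $x,y,z,w$, where $(p,q)_r=\frac12(d(p,r)+d(r,q)-d(p,q))$; this property does not depend on the finite generating set. *)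

theory Defs
  imports Complex_Main "HOL-Algebra.Generated_Groups"
begin

(* A letter (x, False) stands for the generator x, and (x, True) for its formal inverse. *)
type_synonym 'x group_word = "('x \<times> bool) list"

(* Groups given by generators and relations.  The generators are all elements of the type 'x;
   a pair (u, v) in R is the relation u = v. *)
inductive pres_eq :: "('x group_word \<times> 'x group_word) set \<Rightarrow> 'x group_word \<Rightarrow> 'x group_word \<Rightarrow> bool"
  for R :: "('x group_word \<times> 'x group_word) set"
where
  refl: "pres_eq R u u"
| sym: "pres_eq R u v \<Longrightarrow> pres_eq R v u"
| trans: "pres_eq R u v \<Longrightarrow> pres_eq R v w \<Longrightarrow> pres_eq R u w"
| cancel: "pres_eq R (p @ [(x, e), (x, \<not> e)] @ q) (p @ q)"
| rel: "(u, v) \<in> R \<Longrightarrow> pres_eq R (p @ u @ q) (p @ v @ q)"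

definition pres_class :: "('x group_word \<times> 'x group_word) set \<Rightarrow> 'x group_word \<Rightarrow> 'x group_word set"
  where "pres_class R u = {v. pres_eq R u v}"

definition presented_group :: "('x group_word \<times> 'x group_word) set \<Rightarrow> 'x group_word set monoid"
  where "presented_group R =
    \<lparr>carrier = range (pres_class R),
     mult = (\<lambda>U V. \<Union>u\<in>U. \<Union>v\<in>V. pres_class R (u @ v)),
     one = pres_class R []\<rparr>"

lemma pres_eq_append:
  assumes "pres_eq R u u'" and "pres_eq R v v'"
  shows "pres_eq R (u @ v) (u' @ v')"
proof -
  have ctx: "pres_eq R (p @ y @ q) (p @ z @ q)" if "pres_eq R y z" for p q y z
    using that
  proof induction
    case (cancel p' x e q')
    show ?case
      using pres_eq.cancel[of R "p @ p'" x e "q' @ q"] by simp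
  next
    case (rel y z p' q')
    then show ?case
      using pres_eq.rel[of y z R "p @ p'" "q' @ q"] by simp
  next
    case (trans u v w)
    show ?case by (rule pres_eq.trans[OF trans.IH])
  next
    case (sym u v)
    show ?case by (rule pres_eq.sym[OF sym.IH])
  qed (rule pres_eq.refl)
  have "pres_eq R (u @ v) (u' @ v)" "pres_eq R (u' @ v) (u' @ v')"
    using ctx[OF assms(1), of "[]" v] ctx[OF assms(2), of u' "[]"] by simp_all
  then show ?thesis
    by (rule pres_eq.trans)
qed

lemma pres_class_eq_iff: "pres_class R u = pres_class R v \<longleftrightarrow> pres_eq R u v"
proof
  assume "pres_class R u = pres_class R v"
  then have "v \<in> pres_class R u"
    by (simp add: pres_class_def pres_eq.refl)
  then show "pres_eq R u v"
    by (simp add: pres_class_def)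
next
  assume "pres_eq R u v"
  then show "pres_class R u = pres_class R v"
    unfolding pres_class_def by (blast dest: pres_eq.sym pres_eq.trans)
qed

lemma presented_group_mult:
  "pres_class R u \<otimes>\<^bsub>presented_group R\<^esub> pres_class R v = pres_class R (u @ v)"
proof -
  have "pres_class R (u' @ v') = pres_class R (u @ v)"
    if "u' \<in> pres_class R u" "v' \<in> pres_class R v" for u' v'
    using that
    by (simp add: pres_class_eq_iff) (simp add: pres_class_def pres_eq_append pres_eq.sym)
  moreover have "u \<in> pres_class R u" "v \<in> pres_class R v"
    by (auto simp: pres_class_def intro: pres_eq.refl)
  ultimately have "(\<Union>u'\<in>pres_class R u. \<Union>v'\<in>pres_class R v. pres_class R (u' @ v'))
      = pres_class R (u @ v)"
    by blast
  then show ?thesis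
    by (simp add: presented_group_def)
qed

lemma pres_eq_left_inverse:
  "pres_eq R (rev (map (\<lambda>(x, e). (x, \<not> e)) w) @ w) []"
proof (induction w)
  case Nil
  show ?case by (simp add: pres_eq.refl)
next
  case (Cons a w)
  obtain x e where "a = (x, e)" by (cases a)
  then show ?case
    using pres_eq.trans[OF pres_eq.cancel[of R _ x "\<not> e" w] Cons.IH] by simp
qed

lemma group_presented_group: "group (presented_group R)"
proof (rule groupI)
  fix U assume "U \<in> carrier (presented_group R)"
  then obtain u where "U = pres_class R u"
    by (auto simp: presented_group_def)
  moreover have "pres_class R (rev (map (\<lambda>(x, e). (x, \<not> e)) u)) \<otimes>\<^bsub>presented_group R\<^esub> pres_class R u
      = \<one>\<^bsub>presented_group R\<^esub>"
    by (simp only: presented_group_mult)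
      (simp add: presented_group_def pres_class_eq_iff pres_eq_left_inverse)
  ultimately show "\<exists>V\<in>carrier (presented_group R). V \<otimes>\<^bsub>presented_group R\<^esub> U = \<one>\<^bsub>presented_group R\<^esub>"
    by (auto simp: presented_group_def)
next
  fix U assume "U \<in> carrier (presented_group R)"
  then obtain u where "U = pres_class R u"
    by (auto simp: presented_group_def)
  then show "\<one>\<^bsub>presented_group R\<^esub> \<otimes>\<^bsub>presented_group R\<^esub> U = U"
    using presented_group_mult[of R "[]" u] by (simp add: presented_group_def)
next
  show "\<one>\<^bsub>presented_group R\<^esub> \<in> carrier (presented_group R)"
    by (simp add: presented_group_def)
next
  fix U V assume "U \<in> carrier (presented_group R)" "V \<in> carrier (presented_group R)"
  then obtain u v where "U = pres_class R u" "V = pres_class R v"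
    by (auto simp: presented_group_def)
  then show "U \<otimes>\<^bsub>presented_group R\<^esub> V \<in> carrier (presented_group R)"
    by (simp add: presented_group_mult) (simp add: presented_group_def)
next
  fix U V W
  assume "U \<in> carrier (presented_group R)" "V \<in> carrier (presented_group R)"
    "W \<in> carrier (presented_group R)"
  then obtain u v w where "U = pres_class R u" "V = pres_class R v" "W = pres_class R w"
    by (auto simp: presented_group_def)
  then show "U \<otimes>\<^bsub>presented_group R\<^esub> V \<otimes>\<^bsub>presented_group R\<^esub> W
      = U \<otimes>\<^bsub>presented_group R\<^esub> (V \<otimes>\<^bsub>presented_group R\<^esub> W)"
    by (simp add: presented_group_mult)
qed

datatype tab = T | A | B

definition Z_free_prod_Z2 :: "tab group_word set monoid"
  where "Z_free_prod_Z2 = presented_group {([(A, False), (B, False)], [(B, False), (A, False)])}"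

definition symmetric_generating_set :: "('g, 'm) monoid_scheme \<Rightarrow> 'g set \<Rightarrow> bool"
  where "symmetric_generating_set G S \<longleftrightarrow>
    finite S \<and> S \<subseteq> carrier G \<and> \<one>\<^bsub>G\<^esub> \<notin> S \<and> (\<forall>s\<in>S. inv\<^bsub>G\<^esub> s \<in> S) \<and> generate G S = carrier G"

(* Only meaningful when S is closed under inversion: no inverses of letters are taken here. *)
definition word_length :: "('g, 'm) monoid_scheme \<Rightarrow> 'g set \<Rightarrow> 'g \<Rightarrow> nat"
  where "word_length G S g =
    (LEAST n. \<exists>ws. set ws \<subseteq> S \<and> length ws = n \<and> foldr (\<otimes>\<^bsub>G\<^esub>) ws \<one>\<^bsub>G\<^esub> = g)"

definition word_dist :: "('g, 'm) monoid_scheme \<Rightarrow> 'g set \<Rightarrow> 'g \<Rightarrow> 'g \<Rightarrow> real"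
  where "word_dist G S g h = real (word_length G S (inv\<^bsub>G\<^esub> h \<otimes>\<^bsub>G\<^esub> g))"

definition gromov_product :: "('g, 'm) monoid_scheme \<Rightarrow> 'g set \<Rightarrow> 'g \<Rightarrow> 'g \<Rightarrow> 'g \<Rightarrow> real"
  where "gromov_product G S p q r =
    (word_dist G S p r + word_dist G S r q - word_dist G S p q) / 2"

(* Hyperbolicity does not depend on the generating set.  With the existential quantifier over S,
   failure of hyperbolicity means failure for every finite generating set. *)
definition hyperbolic_group :: "('g, 'm) monoid_scheme \<Rightarrow> bool"
  where "hyperbolic_group G \<longleftrightarrow>
    (\<exists>S. symmetric_generating_set G S \<and>
      (\<exists>\<delta>\<ge>0. \<forall>x\<in>carrier G. \<forall>y\<in>carrier G. \<forall>z\<in>carrier G. \<forall>w\<in>carrier G.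
        gromov_product G S x y w \<ge> min (gromov_product G S x z w) (gromov_product G S y z w) - \<delta>))"

definition conj_curvature :: "('g, 'm) monoid_scheme \<Rightarrow> 'g set \<Rightarrow> 'g \<Rightarrow> real"
  where "conj_curvature G S g =
    (real (word_length G S g)
      - 1 / real (card S) * (\<Sum>s\<in>S. real (word_length G S (inv\<^bsub>G\<^esub> s \<otimes>\<^bsub>G\<^esub> g \<otimes>\<^bsub>G\<^esub> s))))
    / real (word_length G S g)"

end

(* Not hyperbolic: the subgroup of A and B is a copy of the plane, and the exponent sums show that
   its word length N grows at least linearly, whatever the generating set.  The four-point
   condition at 0, x, y, x + y passes to tau x = lim N (2^k x) / 2^k without the additive error:
   tau (x + y) + tau (x - y) <= 2 max (tau x) (tau y).  Using this also for x + y and x - y, one of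
   tau (x + y), tau (x - y) must equal |tau x - tau y|, so a Euclidean descent on independent pairs
   (x, y) never stops, although tau is bounded away from 0 on nonzero vectors.

   Negative curvature: the standard generators work.  Conjugating a normal form with at least two
   syllables by s changes its first and last syllables independently.  A generator and its inverse
   together never shorten a syllable of their own factor (convexity of the absolute value), and a
   generator of the other factor adds 1, so the total change over all s is positive. *)
theory Submission
  imports Defs "HOL-Library.Product_Plus"
begin

section \<open>Word length\<close>

context group
begin

lemma foldr_mult_closed: "set ws \<subseteq> carrier G \<Longrightarrow> foldr (\<otimes>) ws \<one> \<in> carrier G"
  by (induction ws) auto

lemma foldr_mult_append:
  "\<lbrakk>set us \<subseteq> carrier G; set vs \<subseteq> carrier G\<rbrakk>
    \<Longrightarrow> foldr (\<otimes>) (us @ vs) \<one> = foldr (\<otimes>) us \<one> \<otimes> foldr (\<otimes>) vs \<one>"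
  by (induction us) (auto simp: m_assoc foldr_mult_closed simp del: foldr_append)

lemma inv_foldr_mult:
  "set ws \<subseteq> carrier G
    \<Longrightarrow> inv (foldr (\<otimes>) ws \<one>) = foldr (\<otimes>) (rev (map (\<lambda>w. inv w) ws)) \<one>"
proof (induction ws)
  case (Cons w ws)
  have "foldr (\<otimes>) (rev (map (\<lambda>w. inv w) ws) @ [inv w]) \<one>
      = foldr (\<otimes>) (rev (map (\<lambda>w. inv w) ws)) \<one> \<otimes> foldr (\<otimes>) [inv w] \<one>"
    by (rule foldr_mult_append) (use Cons.prems in auto)
  then show ?case
    using Cons by (simp add: inv_mult_group foldr_mult_closed del: foldr_append)
qed simp

lemma word_length_le: "set ws \<subseteq> S \<Longrightarrow> word_length G S (foldr (\<otimes>) ws \<one>) \<le> length ws"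
  unfolding word_length_def by (rule Least_le) auto

lemma word_length_one: "word_length G S \<one> = 0"
  using word_length_le[of "[]" S] by simp

text \<open>Closure of \<open>S\<close> under inversion absorbs the inverse case of
  \<open>generate\<close>, so every element is a product of letters of \<open>S\<close> and the
  minimum in \<open>word_length\<close> is attained.\<close>

lemma word_length_witness:
  assumes "symmetric_generating_set G S" and "g \<in> carrier G"
  obtains ws where "set ws \<subseteq> S" "length ws = word_length G S g" "foldr (\<otimes>) ws \<one> = g"
proof -
  have S: "S \<subseteq> carrier G" "\<And>s. s \<in> S \<Longrightarrow> inv s \<in> S"
    using assms(1) by (auto simp: symmetric_generating_set_def)
  have "g \<in> generate G S"
    using assms by (simp add: symmetric_generating_set_def)
  then have "\<exists>ws. set ws \<subseteq> S \<and> foldr (\<otimes>) ws \<one> = g"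
  proof induction
    case one
    show ?case by (intro exI[of _ "[]"]) simp
  next
    case (incl h)
    then show ?case using S by (intro exI[of _ "[h]"]) auto
  next
    case (inv h)
    then show ?case using S by (intro exI[of _ "[inv h]"]) auto
  next
    case (eng h k)
    then obtain us vs where "set us \<subseteq> S" "foldr (\<otimes>) us \<one> = h" "set vs \<subseteq> S" "foldr (\<otimes>) vs \<one> = k"
      by blast
    then show ?case
      using S foldr_mult_append[of us vs] by (intro exI[of _ "us @ vs"]) auto
  qed
  then have "\<exists>n ws. set ws \<subseteq> S \<and> length ws = n \<and> foldr (\<otimes>) ws \<one> = g"
    by blast
  from LeastI_ex[OF this] show ?thesis
    using that unfolding word_length_def by blast
qed

lemma word_length_mult:
  assumes S: "symmetric_generating_set G S" and "g \<in> carrier G" "h \<in> carrier G"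
  shows "word_length G S (g \<otimes> h) \<le> word_length G S g + word_length G S h"
proof -
  obtain us where us: "set us \<subseteq> S" "length us = word_length G S g" "foldr (\<otimes>) us \<one> = g"
    using word_length_witness assms by blast
  obtain vs where vs: "set vs \<subseteq> S" "length vs = word_length G S h" "foldr (\<otimes>) vs \<one> = h"
    using word_length_witness assms by blast
  have "S \<subseteq> carrier G"
    using S by (simp add: symmetric_generating_set_def)
  then have "foldr (\<otimes>) (us @ vs) \<one> = g \<otimes> h"
    using us vs foldr_mult_append[of us vs] by auto
  then show ?thesis
    using word_length_le[of "us @ vs" S] us vs by simp
qed

lemma word_length_inv:
  assumes S: "symmetric_generating_set G S" and g: "g \<in> carrier G"
  shows "word_length G S (inv g) = word_length G S g"
proof -
  have le: "word_length G S (inv h) \<le> word_length G S h" if h: "h \<in> carrier G" for h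
  proof -
    obtain ws where ws: "set ws \<subseteq> S" "length ws = word_length G S h" "foldr (\<otimes>) ws \<one> = h"
      using word_length_witness[OF S h] by blast
    have "set ws \<subseteq> carrier G" "set (rev (map (\<lambda>w. inv w) ws)) \<subseteq> S"
      using S ws(1) by (auto simp: symmetric_generating_set_def)
    then show ?thesis
      using word_length_le[of "rev (map (\<lambda>w. inv w) ws)" S] inv_foldr_mult[of ws] ws by simp
  qed
  show ?thesis
    using le[of g] le[of "inv g"] g by simp
qed

text \<open>Each letter of a shortest word contributes at most \<open>C\<close>. This yields linear
  lower bounds on the word length for an arbitrary generating set.\<close>

lemma additive_le_word_length:
  fixes \<phi> :: "'a \<Rightarrow> int"
  assumes S: "symmetric_generating_set G S" and g: "g \<in> carrier G"
    and add: "\<And>x y. \<lbrakk>x \<in> carrier G; y \<in> carrier G\<rbrakk> \<Longrightarrow> \<phi> (x \<otimes> y) = \<phi> x + \<phi> y"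
    and bound: "\<And>s. s \<in> S \<Longrightarrow> \<bar>\<phi> s\<bar> \<le> C"
  shows "\<bar>\<phi> g\<bar> \<le> C * int (word_length G S g)"
proof -
  have SG: "S \<subseteq> carrier G"
    using S by (simp add: symmetric_generating_set_def)
  have "\<phi> \<one> = 0"
    using add[of \<one> \<one>] by simp
  then have *: "\<bar>\<phi> (foldr (\<otimes>) ws \<one>)\<bar> \<le> C * int (length ws)" if "set ws \<subseteq> S" for ws
    using that
  proof (induction ws)
    case (Cons w ws)
    have "\<phi> (foldr (\<otimes>) (w # ws) \<one>) = \<phi> w + \<phi> (foldr (\<otimes>) ws \<one>)"
      using add[of w "foldr (\<otimes>) ws \<one>"] foldr_mult_closed[of ws] Cons.prems SG by auto
    then show ?case
      using Cons bound[of w] by (simp add: algebra_simps)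
  qed simp
  obtain ws where "set ws \<subseteq> S" "length ws = word_length G S g" "foldr (\<otimes>) ws \<one> = g"
    using word_length_witness[OF S g] by blast
  then show ?thesis
    using *[of ws] by simp
qed

end

section \<open>Four-point inequality on the plane\<close>

lemma no_tree_norm_on_plane:
  fixes \<tau> :: "int \<times> int \<Rightarrow> real"
  assumes even: "\<And>x. \<tau> (- x) = \<tau> x"
    and triangle: "\<And>x y. \<tau> (x + y) \<le> \<tau> x + \<tau> y"
    and double: "\<And>x. \<tau> (x + x) = 2 * \<tau> x"
    and four_point: "\<And>x y. \<tau> (x + y) + \<tau> (x - y) \<le> 2 * max (\<tau> x) (\<tau> y)"
    and lower: "\<And>x. x \<noteq> 0 \<Longrightarrow> c \<le> \<tau> x" and "c > 0"
  shows False
proof -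
  let ?det = "\<lambda>x y :: int \<times> int. fst x * snd y - snd x * fst y"
  \<comment> \<open>At \<open>x + y\<close> and \<open>x - y\<close> the four-point inequality makes
    the larger of \<open>\<tau> (x + y)\<close> and \<open>\<tau> (x - y)\<close> at least
    \<open>\<tau> x + \<tau> y\<close>. Since their sum is at most
    \<open>2 * max (\<tau> x) (\<tau> y)\<close>, the smaller is at most
    \<open>\<bar>\<tau> x - \<tau> y\<bar>\<close>, and the triangle inequality gives
    equality.\<close>
  have diff: "\<tau> (x + y) = \<bar>\<tau> x - \<tau> y\<bar> \<or> \<tau> (x - y) = \<bar>\<tau> x - \<tau> y\<bar>" for x y
  proof -
    have eqs: "(x + y) + (x - y) = x + x" "(x + y) - (x - y) = y + y"
      by simp_all
    have "2 * \<tau> x + 2 * \<tau> y \<le> 2 * max (\<tau> (x + y)) (\<tau> (x - y))"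
      using four_point[of "x + y" "x - y"] unfolding eqs by (simp add: double)
    moreover have "\<tau> x \<le> \<tau> (x + y) + \<tau> y" "\<tau> y \<le> \<tau> (x + y) + \<tau> x"
      "\<tau> x \<le> \<tau> (x - y) + \<tau> y" "\<tau> y \<le> \<tau> (x - y) + \<tau> x"
      using triangle[of "x + y" "- y"] triangle[of "x + y" "- x"] triangle[of "x - y" y]
        triangle[of "- (x - y)" x] even[of x] even[of y] even[of "x - y"] by simp_all
    ultimately show ?thesis
      using four_point[of x y] by (auto simp: max_def abs_if split: if_splits)
  qed
  \<comment> \<open>Descent read backwards: the vector of larger value is replaced by
    \<open>z\<close>, which keeps the determinant nonzero and lowers the sum of the values by the
    smaller one, hence by at least \<open>c\<close>.\<close>
  have "c * real k \<le> \<tau> x + \<tau> y" if "?det x y \<noteq> 0" for k x y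
    using that
  proof (induction k arbitrary: x y)
    case 0
    then have "x \<noteq> 0" "y \<noteq> 0" by auto
    then show ?case using lower[of x] lower[of y] \<open>c > 0\<close> by simp
  next
    case (Suc k)
    then have "x \<noteq> 0" "y \<noteq> 0" by auto
    then have c: "c \<le> \<tau> x" "c \<le> \<tau> y" by (simp_all add: lower)
    obtain z where z: "z = x + y \<or> z = x - y" "\<tau> z = \<bar>\<tau> x - \<tau> y\<bar>"
      using diff by blast
    then have "?det z y \<noteq> 0" "?det x z \<noteq> 0"
      using Suc.prems by (auto simp: algebra_simps)
    then show ?case
      using Suc.IH[of z y] Suc.IH[of x z] z(2) c by (simp add: algebra_simps abs_if split: if_splits)
  qed
  from this[of "(1, 0)" "(0, 1)"] have *: "c * real k \<le> \<tau> (1, 0) + \<tau> (0, 1)" for k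
    by simp
  obtain k where "\<tau> (1, 0) + \<tau> (0, 1) < real k * c"
    using reals_Archimedean3[OF \<open>c > 0\<close>] by blast
  with *[of k] show False by (simp add: mult.commute)
qed

text \<open>Homogenization along powers of 2: the limit of \<open>N (dbl k x) / 2 ^ k\<close> keeps
  evenness and the triangle inequality, gains exact doubling and loses the error \<open>D\<close>,
  which contradicts \<open>no_tree_norm_on_plane\<close>.\<close>

lemma plane_not_hyperbolic:
  fixes N :: "int \<times> int \<Rightarrow> real"
  assumes even: "\<And>x. N (- x) = N x"
    and triangle: "\<And>x y. N (x + y) \<le> N x + N y"
    and four_point: "\<And>x y. N (x + y) + N (x - y) \<le> 2 * max (N x) (N y) + D"
    and lower: "\<And>x. c * real_of_int \<bar>fst x\<bar> \<le> N x" "\<And>x. c * real_of_int \<bar>snd x\<bar> \<le> N x"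
    and "c > 0"
  shows False
proof -
  define dbl where "dbl k x = (2 ^ k * fst x, 2 ^ k * snd x)" for k and x :: "int \<times> int"
  have dbl_add: "dbl k (x + y) = dbl k x + dbl k y" for k x y
    by (simp add: dbl_def algebra_simps)
  have dbl_minus: "dbl k (- x) = - dbl k x" for k x
    by (simp add: dbl_def)
  have dbl_diff: "dbl k (x - y) = dbl k x - dbl k y" for k x y
    by (simp add: dbl_def algebra_simps)
  have dbl_Suc: "dbl (Suc k) x = dbl k x + dbl k x" for k x
    by (simp add: dbl_def)
  have dbl_lower: "c * 2 ^ k \<le> N (dbl k x)" if "x \<noteq> 0" for k x
  proof -
    have "fst x \<noteq> 0 \<or> snd x \<noteq> 0"
      using that by (simp add: prod_eq_iff)
    then have "1 \<le> \<bar>fst x\<bar> \<or> 1 \<le> \<bar>snd x\<bar>" by linarith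
    moreover have "c * 2 ^ k \<le> c * real_of_int \<bar>2 ^ k * i\<bar>" if "1 \<le> \<bar>i\<bar>" for i :: int
      using that \<open>c > 0\<close> by (simp add: abs_mult flip: of_int_abs)
    ultimately show ?thesis
      using lower[of "dbl k x"] unfolding dbl_def fst_conv snd_conv by (meson order_trans)
  qed
  define \<tau> where "\<tau> x = lim (\<lambda>k. N (dbl k x) / 2 ^ k)" for x
  \<comment> \<open>Subadditivity makes the quotients decreasing, and they are nonnegative, so the
    limit exists.\<close>
  have lim: "(\<lambda>k. N (dbl k x) / 2 ^ k) \<longlonglongrightarrow> \<tau> x" for x
  proof -
    have "N (dbl (Suc k) x) \<le> 2 * N (dbl k x)" for k
      using triangle[of "dbl k x" "dbl k x"] by (simp add: dbl_Suc)
    then have "decseq (\<lambda>k. N (dbl k x) / 2 ^ k)"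
      by (simp add: decseq_Suc_iff field_simps)
    moreover have "0 \<le> N (dbl k x) / 2 ^ k" for k
    proof -
      have "0 \<le> c * real_of_int \<bar>fst (dbl k x)\<bar>" using \<open>c > 0\<close> by simp
      then have "0 \<le> N (dbl k x)" using lower(1) by (rule order_trans)
      then show ?thesis by simp
    qed
    ultimately obtain L where "(\<lambda>k. N (dbl k x) / 2 ^ k) \<longlonglongrightarrow> L"
      using decseq_convergent by blast
    then have "convergent (\<lambda>k. N (dbl k x) / 2 ^ k)"
      by (rule convergentI)
    then show ?thesis
      by (simp add: \<tau>_def convergent_LIMSEQ_iff)
  qed
  show False
  proof (rule no_tree_norm_on_plane[of \<tau> c])
    show "\<tau> (- x) = \<tau> x" for x
      by (simp add: \<tau>_def dbl_minus even)
    show "\<tau> (x + y) \<le> \<tau> x + \<tau> y" for x y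
      by (rule LIMSEQ_le[OF lim tendsto_add[OF lim lim]])
        (auto simp: dbl_add triangle divide_right_mono simp flip: add_divide_distrib)
    show "\<tau> (x + x) = 2 * \<tau> x" for x
    proof -
      \<comment> \<open>The sequence of \<open>x + x\<close> is twice the sequence of
        \<open>x\<close> shifted by one index.\<close>
      have "(\<lambda>k. 2 * (N (dbl (Suc k) x) / 2 ^ Suc k)) \<longlonglongrightarrow> 2 * \<tau> x"
        by (intro tendsto_mult_left LIMSEQ_Suc lim)
      then have "(\<lambda>k. N (dbl k (x + x)) / 2 ^ k) \<longlonglongrightarrow> 2 * \<tau> x"
        by (simp add: dbl_Suc dbl_add)
      then show ?thesis
        using lim LIMSEQ_unique by blast
    qed
    show "\<tau> (x + y) + \<tau> (x - y) \<le> 2 * max (\<tau> x) (\<tau> y)" for x y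
    proof (rule LIMSEQ_le[OF tendsto_add[OF lim lim]])
      have "(\<lambda>k. D * (1 / 2) ^ k) \<longlonglongrightarrow> D * 0"
        by (intro tendsto_mult_left LIMSEQ_power_zero) simp
      then show "(\<lambda>k. 2 * max (N (dbl k x) / 2 ^ k) (N (dbl k y) / 2 ^ k) + D * (1 / 2) ^ k)
          \<longlonglongrightarrow> 2 * max (\<tau> x) (\<tau> y)"
        using tendsto_add[OF tendsto_mult_left[OF tendsto_max[OF lim lim]]] by fastforce
      have "N (dbl k (x + y)) / 2 ^ k + N (dbl k (x - y)) / 2 ^ k
          \<le> 2 * max (N (dbl k x) / 2 ^ k) (N (dbl k y) / 2 ^ k) + D * (1 / 2) ^ k" for k
        using four_point[of "dbl k x" "dbl k y"]
        by (simp add: dbl_add dbl_diff max_def power_divide divide_simps split: if_splits)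
      then show "\<exists>n. \<forall>k\<ge>n. N (dbl k (x + y)) / 2 ^ k + N (dbl k (x - y)) / 2 ^ k
          \<le> 2 * max (N (dbl k x) / 2 ^ k) (N (dbl k y) / 2 ^ k) + D * (1 / 2) ^ k"
        by blast
    qed
    show "c \<le> \<tau> x" if "x \<noteq> 0" for x
      by (rule LIMSEQ_le_const[OF lim]) (use dbl_lower[OF that] in \<open>auto simp: field_simps\<close>)
  qed fact
qed

section \<open>Normal forms in the free product\<close>

text \<open>\<open>Syl_T k\<close> stands for t^k and \<open>Syl_AB i j\<close> for a^i b^j. A list
  of nontrivial syllables alternating between the factors is a normal form of the free
  product.\<close>

datatype syllable = is_T: Syl_T int | Syl_AB int int

text \<open>Only meaningful on syllables of the same factor.\<close>

fun syl_add :: "syllable \<Rightarrow> syllable \<Rightarrow> syllable" where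
  "syl_add (Syl_T k) (Syl_T l) = Syl_T (k + l)"
| "syl_add (Syl_AB i j) (Syl_AB k l) = Syl_AB (i + k) (j + l)"
| "syl_add x _ = x"

fun syl_size :: "syllable \<Rightarrow> int" where
  "syl_size (Syl_T k) = \<bar>k\<bar>"
| "syl_size (Syl_AB i j) = \<bar>i\<bar> + \<bar>j\<bar>"

fun letter_syl :: "tab \<times> bool \<Rightarrow> syllable" where
  "letter_syl (T, e) = Syl_T (if e then - 1 else 1)"
| "letter_syl (A, e) = Syl_AB (if e then - 1 else 1) 0"
| "letter_syl (B, e) = Syl_AB 0 (if e then - 1 else 1)"

definition syl_cons :: "syllable \<Rightarrow> syllable list \<Rightarrow> syllable list" where
  "syl_cons x w = (if syl_size x = 0 then w else x # w)"

text \<open>Left multiplication by a syllable on normal forms (van der Waerden's method): words act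
  on reduced lists, so uniqueness of normal forms follows once the defining relations hold for this
  action, without a confluence argument.\<close>

fun act :: "syllable \<Rightarrow> syllable list \<Rightarrow> syllable list" where
  "act x [] = syl_cons x []"
| "act x (y # w) = (if is_T x = is_T y then syl_cons (syl_add x y) w else syl_cons x (y # w))"

definition reduced :: "syllable list \<Rightarrow> bool" where
  "reduced w \<longleftrightarrow> successively (\<lambda>x y. is_T x \<noteq> is_T y) w \<and> (\<forall>x\<in>set w. syl_size x \<noteq> 0)"

definition nf :: "tab group_word \<Rightarrow> syllable list" where
  "nf u = foldr (\<lambda>l. act (letter_syl l)) u []"

definition total_size :: "syllable list \<Rightarrow> int" where
  "total_size w = (\<Sum>x\<leftarrow>w. syl_size x)"

lemma syl_size_nonneg: "0 \<le> syl_size x"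
  by (cases x) auto

lemma syl_size_letter: "syl_size (letter_syl l) = 1"
  by (cases l rule: letter_syl.cases) auto

lemma reduced_Nil: "reduced []"
  by (simp add: reduced_def)

lemma is_T_syl_add [simp]: "is_T (syl_add x y) = is_T x"
  by (cases x; cases y) auto

lemma syl_add_assoc:
  "\<lbrakk>is_T x = is_T y; is_T y = is_T z\<rbrakk> \<Longrightarrow> syl_add (syl_add x y) z = syl_add x (syl_add y z)"
  by (cases x; cases y; cases z) auto

lemma syl_add_commute: "is_T x = is_T y \<Longrightarrow> syl_add x y = syl_add y x"
  by (cases x; cases y) auto

lemma syl_add_trivial: "syl_size y = 0 \<Longrightarrow> syl_add x y = x"
  by (cases x; cases y) auto

lemma reduced_Cons:
  "reduced (x # w) \<longleftrightarrow> syl_size x \<noteq> 0 \<and> reduced w \<and> (w = [] \<or> is_T x \<noteq> is_T (hd w))"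
  by (auto simp: reduced_def successively_Cons)

lemma reduced_append:
  "reduced (v @ w) \<longleftrightarrow>
    reduced v \<and> reduced w \<and> (v = [] \<or> w = [] \<or> is_T (last v) \<noteq> is_T (hd w))"
  by (auto simp: reduced_def successively_append_iff)

lemma act_eq_syl_cons: "w = [] \<or> is_T x \<noteq> is_T (hd w) \<Longrightarrow> act x w = syl_cons x w"
  by (cases w) auto

lemma reduced_act: "reduced w \<Longrightarrow> reduced (act x w)"
  by (cases w) (auto simp: reduced_Cons syl_cons_def reduced_Nil)

lemma act_trivial: "\<lbrakk>syl_size x = 0; reduced w\<rbrakk> \<Longrightarrow> act x w = w"
  by (cases w) (auto simp: reduced_Cons syl_cons_def syl_add_commute[of x] syl_add_trivial)

text \<open>If \<open>y\<close> cancels the head \<open>z\<close> of \<open>w\<close>, the next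
  syllable lies in the other factor because \<open>w\<close> is reduced. So \<open>x\<close> does
  not merge any further, and the sum of \<open>x\<close>, \<open>y\<close> and \<open>z\<close> is
  \<open>x\<close> as well.\<close>

lemma act_act:
  assumes "is_T x = is_T y" "reduced w"
  shows "act x (act y w) = act (syl_add x y) w"
proof (cases "w = [] \<or> is_T y \<noteq> is_T (hd w)")
  case True
  then show ?thesis
    using assms by (cases "syl_size y = 0") (simp_all add: act_eq_syl_cons syl_cons_def syl_add_trivial)
next
  case False
  then obtain z v where w: "w = z # v" "is_T y = is_T z"
    by (cases w) auto
  then have v: "v = [] \<or> is_T x \<noteq> is_T (hd v)"
    using assms by (auto simp: reduced_Cons)
  show ?thesis
  proof (cases "syl_size (syl_add y z) = 0")
    case True
    then show ?thesis
      using assms w v by (simp add: syl_cons_def act_eq_syl_cons syl_add_assoc syl_add_trivial)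
  next
    case False
    then show ?thesis
      using assms w by (simp add: syl_cons_def syl_add_assoc)
  qed
qed

lemma syl_size_add_le: "syl_size (syl_add x y) \<le> syl_size x + syl_size y"
  by (cases x; cases y) auto

lemma total_size_act_le: "total_size (act x w) \<le> syl_size x + total_size w"
  using syl_size_nonneg[of x] syl_size_add_le[of x "hd w"] syl_size_nonneg[of "syl_add x (hd w)"]
  by (cases w) (auto simp: total_size_def syl_cons_def)

lemma reduced_foldr_act: "reduced w \<Longrightarrow> reduced (foldr act v w)"
  by (induction v) (auto simp: reduced_act)

lemma reduced_nf: "reduced (nf u)"
  unfolding nf_def by (induction u) (auto simp: reduced_Nil reduced_act)

lemma nf_append: "nf (u @ v) = foldr (\<lambda>l. act (letter_syl l)) u (nf v)"
  by (simp add: nf_def)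

lemma foldr_syl_cons:
  "reduced z \<Longrightarrow> foldr act (syl_cons x w) z = act x (foldr act w z)"
  by (simp add: syl_cons_def act_trivial reduced_foldr_act)

lemma foldr_act_act:
  "reduced z \<Longrightarrow> foldr act (act x w) z = act x (foldr act w z)"
  by (cases w) (simp_all add: foldr_syl_cons act_act reduced_foldr_act)

text \<open>Lets products, and hence conjugates, be computed from the syllables of the normal form
  of \<open>u\<close> rather than from its letters.\<close>

lemma nf_append_eq_foldr_act: "nf (u @ v) = foldr act (nf u) (nf v)"
proof (induction u)
  case (Cons l u)
  have "nf (l # u @ v) = act (letter_syl l) (nf (u @ v))" "nf (l # u) = act (letter_syl l) (nf u)"
    by (simp_all add: nf_def)
  with Cons show ?case by (simp add: foldr_act_act reduced_nf)
qed (simp add: nf_def)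

lemma foldr_act_reduced: "reduced (v @ w) \<Longrightarrow> foldr act v w = v @ w"
proof (induction v)
  case (Cons x v)
  then show ?case by (simp add: reduced_Cons act_eq_syl_cons syl_cons_def)
qed simp

abbreviation tab_rels :: "(tab group_word \<times> tab group_word) set" where
  "tab_rels \<equiv> {([(A, False), (B, False)], [(B, False), (A, False)])}"

text \<open>A cancelling pair and the relation ab = ba each live inside one factor, where
  \<open>act_act\<close> reduces composition to the commutative \<open>syl_add\<close>. Thus
  \<open>nf\<close> depends only on the group element.\<close>

lemma nf_pres_eq: "pres_eq tab_rels u v \<Longrightarrow> nf u = nf v"
proof (induction rule: pres_eq.induct)
  case (cancel p x e q)
  have "act (letter_syl (x, e)) (act (letter_syl (x, \<not> e)) (nf q)) = nf q"
    by (cases x) (auto simp: act_act act_trivial reduced_nf)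
  then show ?case by (simp add: nf_append) (simp add: nf_def)
next
  case (rel u v p q)
  have "act (Syl_AB 1 0) (act (Syl_AB 0 1) w) = act (Syl_AB 0 1) (act (Syl_AB 1 0) w)" if "reduced w" for w
    using that by (simp add: act_act)
  then show ?case using rel reduced_nf[of q] by (auto simp: nf_append) (simp add: nf_def)
qed auto

lemma total_size_nf_le: "total_size (nf u) \<le> int (length u)"
proof (induction u)
  case (Cons l u)
  then show ?case
    using syl_size_letter[of l] total_size_act_le[of "letter_syl l" "nf u"] by (simp add: nf_def)
qed (simp add: nf_def total_size_def)

section \<open>Normal forms as a complete invariant of group elements\<close>

abbreviation \<open>FG \<equiv> Z_free_prod_Z2\<close>

interpretation FG: group FG
  unfolding Z_free_prod_Z2_def by (rule group_presented_group)

definition cls :: "tab group_word \<Rightarrow> tab group_word set" where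
  "cls = pres_class tab_rels"

lemma carrier_FG: "carrier FG = range cls"
  by (simp add: Z_free_prod_Z2_def presented_group_def cls_def)

lemma cls_carrier [simp]: "cls u \<in> carrier FG"
  by (simp add: carrier_FG)

lemma one_FG: "\<one>\<^bsub>FG\<^esub> = cls []"
  by (simp add: Z_free_prod_Z2_def presented_group_def cls_def)

lemma cls_mult: "cls u \<otimes>\<^bsub>FG\<^esub> cls v = cls (u @ v)"
  unfolding Z_free_prod_Z2_def cls_def by (rule presented_group_mult)

lemma nf_cong: "cls u = cls v \<Longrightarrow> nf u = nf v"
  by (simp add: cls_def pres_class_eq_iff nf_pres_eq)

lemma inv_cls_letter: "inv\<^bsub>FG\<^esub> (cls [(x, e)]) = cls [(x, \<not> e)]"
proof (rule FG.inv_equality)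
  show "cls [(x, \<not> e)] \<otimes>\<^bsub>FG\<^esub> cls [(x, e)] = \<one>\<^bsub>FG\<^esub>"
    using pres_eq.cancel[of tab_rels "[]" x "\<not> e" "[]"]
    by (simp add: cls_mult one_FG) (simp add: cls_def pres_class_eq_iff)
qed simp_all

fun syl_val :: "syllable \<Rightarrow> tab group_word set" where
  "syl_val (Syl_T k) = cls [(T, False)] [^]\<^bsub>FG\<^esub> k"
| "syl_val (Syl_AB i j) = cls [(A, False)] [^]\<^bsub>FG\<^esub> i \<otimes>\<^bsub>FG\<^esub> cls [(B, False)] [^]\<^bsub>FG\<^esub> j"

definition nf_val :: "syllable list \<Rightarrow> tab group_word set" where
  "nf_val w = foldr (\<lambda>x. (\<otimes>\<^bsub>FG\<^esub>) (syl_val x)) w \<one>\<^bsub>FG\<^esub>"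

lemma (in group) int_pow_commute:
  fixes i j :: int
  assumes "x \<otimes> y = y \<otimes> x" "x \<in> carrier G" "y \<in> carrier G"
  shows "x [^] i \<otimes> y [^] j = y [^] j \<otimes> x [^] i"
proof -
  have *: "z [^] k \<otimes> v = v \<otimes> z [^] k"
    if "z \<otimes> v = v \<otimes> z" "z \<in> carrier G" "v \<in> carrier G" for z v and k :: int
  proof -
    have pow: "z [^] n \<otimes> v = v \<otimes> z [^] n" for n :: nat
      using that by (rule group_commutes_pow)
    have inv: "inv u \<otimes> v = v \<otimes> inv u" if "u \<otimes> v = v \<otimes> u" "u \<in> carrier G" for u
    proof -
      have "inv u \<otimes> v = inv u \<otimes> (v \<otimes> u) \<otimes> inv u"
        using that(2) \<open>v \<in> carrier G\<close> by (simp add: m_assoc)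
      also have "\<dots> = inv u \<otimes> (u \<otimes> v) \<otimes> inv u"
        by (simp only: that(1))
      also have "\<dots> = v \<otimes> inv u"
        using that(2) \<open>v \<in> carrier G\<close> by (simp flip: m_assoc)
      finally show ?thesis .
    qed
    show ?thesis
      using pow[of "nat k"] inv[OF pow[of "nat (- k)"] nat_pow_closed[OF \<open>z \<in> carrier G\<close>]]
      by (cases "k < 0") (simp_all only: int_pow_def2 if_True if_False)
  qed
  show ?thesis
    using assms by (intro * *[symmetric]) auto
qed

lemma A_B_commute: "cls [(A, False)] \<otimes>\<^bsub>FG\<^esub> cls [(B, False)] = cls [(B, False)] \<otimes>\<^bsub>FG\<^esub> cls [(A, False)]"
  using pres_eq.rel[of "[(A, False), (B, False)]" "[(B, False), (A, False)]" tab_rels "[]" "[]"]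
  by (simp add: cls_mult) (simp add: cls_def pres_class_eq_iff)

lemma syl_val_carrier [simp]: "syl_val x \<in> carrier FG"
  by (cases x) auto

text \<open>For two \<open>Syl_AB\<close> syllables the inner powers of b and a trade places; this
  is where the relation ab = ba enters the evaluation.\<close>

lemma syl_val_add: "is_T x = is_T y \<Longrightarrow> syl_val (syl_add x y) = syl_val x \<otimes>\<^bsub>FG\<^esub> syl_val y"
proof (cases x; cases y)
  fix i j k l
  let ?a = "\<lambda>i::int. cls [(A, False)] [^]\<^bsub>FG\<^esub> i" and ?b = "\<lambda>i::int. cls [(B, False)] [^]\<^bsub>FG\<^esub> i"
  assume xy: "x = Syl_AB i j" "y = Syl_AB k l"
  have "?a i \<otimes>\<^bsub>FG\<^esub> ?a k \<otimes>\<^bsub>FG\<^esub> (?b j \<otimes>\<^bsub>FG\<^esub> ?b l)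
      = ?a i \<otimes>\<^bsub>FG\<^esub> (?a k \<otimes>\<^bsub>FG\<^esub> ?b j) \<otimes>\<^bsub>FG\<^esub> ?b l"
    by (simp add: FG.m_assoc)
  also have "?a k \<otimes>\<^bsub>FG\<^esub> ?b j = ?b j \<otimes>\<^bsub>FG\<^esub> ?a k"
    by (rule FG.int_pow_commute[OF A_B_commute]) simp_all
  finally show ?thesis
    using xy by (simp add: FG.int_pow_mult FG.m_assoc)
qed (auto simp: FG.int_pow_mult)

lemma syl_val_trivial: "syl_size x = 0 \<Longrightarrow> syl_val x = \<one>\<^bsub>FG\<^esub>"
  by (cases x) (simp_all add: add_nonneg_eq_0_iff)

lemma syl_val_letter: "syl_val (letter_syl l) = cls [l]"
  by (cases l rule: letter_syl.cases) (auto simp: FG.int_pow_neg inv_cls_letter)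

lemma nf_val_carrier [simp]: "nf_val w \<in> carrier FG"
  unfolding nf_val_def by (induction w) auto

lemma nf_val_Cons: "nf_val (x # w) = syl_val x \<otimes>\<^bsub>FG\<^esub> nf_val w"
  by (simp add: nf_val_def)

lemma nf_val_cons: "nf_val (syl_cons x w) = syl_val x \<otimes>\<^bsub>FG\<^esub> nf_val w"
  by (simp add: syl_cons_def syl_val_trivial nf_val_Cons)

lemma nf_val_act: "nf_val (act x w) = syl_val x \<otimes>\<^bsub>FG\<^esub> nf_val w"
  by (cases w) (auto simp: nf_val_cons nf_val_Cons syl_val_add FG.m_assoc)

text \<open>Evaluation turns the action into multiplication, so a normal form determines its
  element. With \<open>nf_cong\<close> it is a complete invariant.\<close>

lemma nf_val_nf: "nf_val (nf u) = cls u"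
proof (induction u)
  case (Cons l u)
  then show ?case
    by (simp add: nf_def nf_val_act syl_val_letter cls_mult)
qed (simp add: nf_def nf_val_def one_FG)

section \<open>Curvature for the standard generators\<close>

definition gens :: "tab group_word set set" where
  "gens = (\<lambda>l. cls [l]) ` UNIV"

lemma UNIV_letters:
  "(UNIV :: (tab \<times> bool) set) = {(T, False), (T, True), (A, False), (A, True), (B, False), (B, True)}"
proof -
  have "l \<in> {(T, False), (T, True), (A, False), (A, True), (B, False), (B, True)}" for l :: "tab \<times> bool"
    by (cases l rule: letter_syl.cases) auto
  then show ?thesis by blast
qed

lemma nf_letter: "nf [l] = [letter_syl l]"
  by (cases l rule: letter_syl.cases) (auto simp: nf_def syl_cons_def)

lemma inj_cls_letter: "inj (\<lambda>l. cls [l])"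
proof (rule injI)
  fix k l :: "tab \<times> bool"
  assume "cls [k] = cls [l]"
  then have "letter_syl k = letter_syl l"
    using nf_cong[of "[k]" "[l]"] by (simp add: nf_letter)
  then show "k = l"
    by (cases k rule: letter_syl.cases; cases l rule: letter_syl.cases) (auto split: if_splits)
qed

lemma generating_gens: "symmetric_generating_set FG gens"
  unfolding symmetric_generating_set_def
proof (intro conjI)
  show "finite gens" by (simp add: gens_def UNIV_letters)
  show sub: "gens \<subseteq> carrier FG" by (auto simp: gens_def)
  show "\<one>\<^bsub>FG\<^esub> \<notin> gens"
  proof
    assume "\<one>\<^bsub>FG\<^esub> \<in> gens"
    then obtain l where "cls [] = cls [l]" by (auto simp: gens_def one_FG)
    then show False using nf_cong[of "[]" "[l]"] by (simp add: nf_letter) (simp add: nf_def)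
  qed
  show "\<forall>s\<in>gens. inv\<^bsub>FG\<^esub> s \<in> gens"
    by (auto simp: gens_def inv_cls_letter)
  have "cls u \<in> generate FG gens" for u
  proof (induction u)
    case Nil
    show ?case using generate.one[of FG gens] by (simp add: one_FG)
  next
    case (Cons l u)
    have "cls [l] \<in> generate FG gens" by (rule generate.incl) (simp add: gens_def)
    then show ?case using generate.eng[OF _ Cons, of "cls [l]"] by (simp add: cls_mult)
  qed
  then show "generate FG gens = carrier FG"
    using FG.generate_in_carrier[OF sub] by (auto simp: carrier_FG)
qed

lemma word_length_gens_pow: "word_length FG gens (cls [l] [^]\<^bsub>FG\<^esub> (k::int)) \<le> nat \<bar>k\<bar>"
proof -
  have nat: "word_length FG gens (cls [l] [^]\<^bsub>FG\<^esub> (n::nat)) \<le> n" for n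
  proof (induction n)
    case 0
    show ?case by (simp add: FG.word_length_one)
  next
    case (Suc n)
    have "word_length FG gens (cls [l]) \<le> 1"
      using FG.word_length_le[of "[cls [l]]" gens] by (simp add: gens_def)
    then show ?case
      using Suc FG.word_length_mult[OF generating_gens, of "cls [l] [^]\<^bsub>FG\<^esub> n" "cls [l]"] by simp
  qed
  show ?thesis
  proof (cases "0 \<le> k")
    case True
    then show ?thesis using nat[of "nat k"] int_pow_int[of FG "cls [l]" "nat k"] by simp
  next
    case False
    then obtain n where "k = - int n" by (metis int_cases2 of_nat_0_le_iff)
    then show ?thesis
      using nat[of n] by (simp add: FG.int_pow_neg int_pow_int FG.word_length_inv[OF generating_gens])
  qed
qed

lemma word_length_syl_val: "int (word_length FG gens (syl_val x)) \<le> syl_size x"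
proof (cases x)
  case (Syl_T k)
  then show ?thesis using word_length_gens_pow[of "(T, False)" k] by simp
next
  case (Syl_AB i j)
  then show ?thesis
    using word_length_gens_pow[of "(A, False)" i] word_length_gens_pow[of "(B, False)" j]
      FG.word_length_mult[OF generating_gens, of "cls [(A, False)] [^]\<^bsub>FG\<^esub> i" "cls [(B, False)] [^]\<^bsub>FG\<^esub> j"]
    by simp
qed

lemma word_length_nf_val: "int (word_length FG gens (nf_val w)) \<le> total_size w"
proof (induction w)
  case Nil
  show ?case by (simp add: nf_val_def FG.word_length_one total_size_def)
next
  case (Cons x w)
  then show ?case
    using FG.word_length_mult[OF generating_gens, of "syl_val x" "nf_val w"] word_length_syl_val[of x]
    by (simp add: nf_val_Cons total_size_def)
qed

text \<open>Normal forms are geodesic. Evaluating one syllable by syllable gives the upper bound;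
  conversely a word over \<open>gens\<close> lifts to letters, and each letter raises the size of
  the normal form by at most 1.\<close>

lemma word_length_gens: "int (word_length FG gens (cls u)) = total_size (nf u)"
proof (rule antisym)
  show "int (word_length FG gens (cls u)) \<le> total_size (nf u)"
    using word_length_nf_val[of "nf u"] by (simp add: nf_val_nf)
  obtain ws where ws: "set ws \<subseteq> gens" "length ws = word_length FG gens (cls u)"
    "foldr (\<otimes>\<^bsub>FG\<^esub>) ws \<one>\<^bsub>FG\<^esub> = cls u"
    using FG.word_length_witness[OF generating_gens, of "cls u"] by auto
  have "\<exists>v. length v = length ws \<and> foldr (\<otimes>\<^bsub>FG\<^esub>) ws \<one>\<^bsub>FG\<^esub> = cls v"
    using ws(1)
  proof (induction ws)
    case Nil
    show ?case by (simp add: one_FG)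
  next
    case (Cons s ws)
    then obtain l v where "s = cls [l]" "length v = length ws"
      "foldr (\<otimes>\<^bsub>FG\<^esub>) ws \<one>\<^bsub>FG\<^esub> = cls v"
      by (auto simp: gens_def)
    then show ?case by (intro exI[of _ "l # v"]) (simp add: cls_mult)
  qed
  then obtain v where "length v = length ws" "cls u = cls v"
    using ws(3) by auto
  then show "total_size (nf u) \<le> int (word_length FG gens (cls u))"
    using total_size_nf_le[of v] nf_cong[of u v] ws(2) by simp
qed

text \<open>Change in length when \<open>y\<close> multiplies from the left a normal form with first
  syllable \<open>x\<close>. As the factors are commutative, it also measures multiplication from
  the right onto a last syllable \<open>x\<close>.\<close>

definition size_change :: "syllable \<Rightarrow> syllable \<Rightarrow> int" where
  "size_change y x =
    (if is_T y = is_T x then syl_size (syl_add y x) - syl_size x else syl_size y)"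

lemma total_size_act: "total_size (act y (x # w)) = total_size (x # w) + size_change y x"
proof -
  have "total_size (syl_cons z v) = syl_size z + total_size v" for z v
    by (simp add: syl_cons_def total_size_def)
  then show ?thesis
    by (simp add: size_change_def) (simp add: total_size_def)
qed

lemma total_size_conj:
  assumes red: "reduced (x # w @ [y])" and l: "syl_size l \<noteq> 0"
  shows "total_size (act k (foldr act (x # w @ [y]) [l]))
    = total_size (x # w @ [y]) + size_change k x + size_change l y"
proof -
  have y: "syl_size y \<noteq> 0" and xw: "reduced (x # w)" "is_T (last (x # w)) \<noteq> is_T y"
    using red reduced_append[of "x # w" "[y]"] by (auto simp: reduced_Cons)
  \<comment> \<open>Either \<open>l\<close> cancels \<open>y\<close>, or the first syllable left
    lies in the factor of \<open>y\<close>. In both cases \<open>x # w\<close> stays untouched in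
    front, so the two ends change independently.\<close>
  have "act y [l] = [] \<or> is_T (hd (act y [l])) = is_T y"
    by (auto simp: syl_cons_def y)
  moreover have "reduced (act y [l])"
    by (rule reduced_act) (simp add: reduced_Cons l reduced_Nil)
  ultimately have "reduced ((x # w) @ act y [l])"
    unfolding reduced_append using xw by auto
  from foldr_act_reduced[OF this]
  have "foldr act (x # w @ [y]) [l] = x # w @ act y [l]"
    by simp
  moreover have "total_size (act y [l]) = syl_size y + size_change l y"
    by (auto simp: size_change_def total_size_def syl_cons_def y syl_add_commute[of y])
  ultimately show ?thesis
    using total_size_act[of k x "w @ act y [l]"] by (simp add: total_size_def)
qed

text \<open>The factors are abelian, so a letter of the same factor changes nothing; a letter of the
  other factor leaves a new syllable of size 1 on each side.\<close>

lemma total_size_conj_single: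
  assumes "syl_size x \<noteq> 0"
  shows "total_size (act (letter_syl (a, \<not> e)) (act x [letter_syl (a, e)]))
    = syl_size x + (if is_T x = (a = T) then 0 else 2)"
  using assms by (cases x; cases a) (auto simp: syl_cons_def total_size_def)

text \<open>Pairing each letter with its inverse, convexity of the absolute value makes the
  contribution of the factor of \<open>x\<close> nonnegative; each letter of the other factor
  contributes 1.\<close>

lemma sum_size_change_pos:
  assumes "syl_size x \<noteq> 0"
  shows "0 < (\<Sum>(a, e)\<in>UNIV. size_change (letter_syl (a, e)) x)"
  using assms by (cases x) (auto simp: UNIV_letters size_change_def)

text \<open>Negative curvature with denominators cleared; 6 is the number of letters.\<close>

lemma sum_conj_word_length:
  assumes "nf u \<noteq> []"
  shows "6 * word_length FG gens (cls u)
    < (\<Sum>s\<in>gens. word_length FG gens (inv\<^bsub>FG\<^esub> s \<otimes>\<^bsub>FG\<^esub> cls u \<otimes>\<^bsub>FG\<^esub> s))"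
proof -
  let ?conj = "\<lambda>(a, e). total_size (act (letter_syl (a, \<not> e)) (foldr act (nf u) [letter_syl (a, e)]))"
  have "int (word_length FG gens (inv\<^bsub>FG\<^esub> (cls [l]) \<otimes>\<^bsub>FG\<^esub> cls u \<otimes>\<^bsub>FG\<^esub> cls [l])) = ?conj l" for l
  proof (cases l)
    case (Pair a e)
    have "nf ([(a, \<not> e)] @ u @ [(a, e)])
        = act (letter_syl (a, \<not> e)) (foldr act (nf u) [letter_syl (a, e)])"
      by (simp only: nf_append[of "[_]"] nf_append_eq_foldr_act[of u] nf_letter) simp
    then show ?thesis
      by (simp add: Pair inv_cls_letter cls_mult word_length_gens)
  qed
  then have sum: "int (\<Sum>s\<in>gens. word_length FG gens (inv\<^bsub>FG\<^esub> s \<otimes>\<^bsub>FG\<^esub> cls u \<otimes>\<^bsub>FG\<^esub> s))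
      = (\<Sum>l\<in>UNIV. ?conj l)"
    by (simp add: gens_def sum.reindex[OF inj_cls_letter])
  have red: "reduced (nf u)" by (rule reduced_nf)
  have "6 * total_size (nf u) < (\<Sum>l\<in>UNIV. ?conj l)"
  proof (cases "\<exists>x. nf u = [x]")
    \<comment> \<open>Both ends coincide, so \<open>total_size_conj\<close> does not apply; the
      letters of the other factor, two or four of them, contribute 2 each.\<close>
    case True
    then obtain x where x: "nf u = [x]" by blast
    with red have "syl_size x \<noteq> 0" by (simp add: reduced_Cons)
    then have "(\<Sum>l\<in>UNIV. ?conj l)
        = (\<Sum>(a, e :: bool)\<in>UNIV. syl_size x + (if is_T x = (a = T) then 0 else 2))"
      by (simp add: x total_size_conj_single del: act.simps)
    then show ?thesis
      by (simp add: x UNIV_letters total_size_def)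
  next
    case False
    then obtain x v where "nf u = x # v" "v \<noteq> []"
      using assms by (cases "nf u") auto
    then obtain w y where xwy: "nf u = x # w @ [y]"
      by (cases v rule: rev_cases) auto
    have ne: "syl_size x \<noteq> 0" "syl_size y \<noteq> 0"
      using red unfolding xwy reduced_def by auto
    \<comment> \<open>As the letter on the right runs over all letters, so does its inverse on the
      left. Hence each end contributes a full, positive sum of \<open>size_change\<close>.\<close>
    have "(\<Sum>l\<in>UNIV. ?conj l) = (\<Sum>(a, e)\<in>UNIV. total_size (nf u)
        + size_change (letter_syl (a, \<not> e)) x + size_change (letter_syl (a, e)) y)"
      using red unfolding xwy by (intro sum.cong) (auto simp only: total_size_conj syl_size_letter split: prod.splits)
    then show ?thesis
      using sum_size_change_pos[OF ne(1)] sum_size_change_pos[OF ne(2)] by (simp add: UNIV_letters)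
  qed
  then show ?thesis
    using sum word_length_gens[of u] by linarith
qed

lemma conj_curvature_gens_neg:
  assumes "g \<in> carrier FG" "g \<noteq> \<one>\<^bsub>FG\<^esub>"
  shows "conj_curvature FG gens g < 0"
proof -
  obtain u where g: "g = cls u"
    using assms(1) by (auto simp: carrier_FG)
  have nf: "nf u \<noteq> []"
  proof
    assume "nf u = []"
    then have "nf_val (nf u) = \<one>\<^bsub>FG\<^esub>" by (simp add: nf_val_def)
    with assms(2) show False by (simp only: g nf_val_nf)
  qed
  \<comment> \<open>The length is the denominator of the curvature; were it 0, the quotient would be
    0 by convention and not negative.\<close>
  have "0 < total_size (nf u)"
  proof (cases "nf u")
    case (Cons x w)
    then have "syl_size x \<noteq> 0"
      using reduced_nf[of u] by (simp add: reduced_Cons)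
    moreover have "0 \<le> (\<Sum>y\<leftarrow>w. syl_size y)"
      by (rule sum_list_nonneg) (auto simp: syl_size_nonneg)
    ultimately show ?thesis
      using syl_size_nonneg[of x] by (simp add: Cons total_size_def)
  qed (use nf in simp)
  then have pos: "0 < word_length FG gens g"
    using word_length_gens[of u] by (simp add: g)
  have card: "card gens = 6"
    unfolding gens_def card_image[OF inj_cls_letter] by (simp add: UNIV_letters)
  have "6 * real (word_length FG gens g)
    < (\<Sum>s\<in>gens. real (word_length FG gens (inv\<^bsub>FG\<^esub> s \<otimes>\<^bsub>FG\<^esub> g \<otimes>\<^bsub>FG\<^esub> s)))"
    using of_nat_less_iff[where ?'a = real, THEN iffD2, OF sum_conj_word_length[OF nf]] by (simp add: g)
  then show ?thesis
    using pos by (simp add: conj_curvature_def card divide_less_0_iff)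
qed

section \<open>Failure of hyperbolicity\<close>

definition exp_sum :: "tab \<Rightarrow> tab group_word \<Rightarrow> int" where
  "exp_sum x u = (\<Sum>(y, e)\<leftarrow>u. if y = x then if e then - 1 else 1 else 0)"

lemma exp_sum_pres_eq: "pres_eq tab_rels u v \<Longrightarrow> exp_sum x u = exp_sum x v"
  by (induction rule: pres_eq.induct) (auto simp: exp_sum_def)

text \<open>The exponent sum on classes, taken at a chosen representative;
  \<open>exp_hom_cls\<close> removes the choice.\<close>

definition exp_hom :: "tab \<Rightarrow> tab group_word set \<Rightarrow> int" where
  "exp_hom x U = exp_sum x (SOME u. cls u = U)"

lemma exp_hom_cls: "exp_hom x (cls u) = exp_sum x u"
proof -
  have "cls (SOME v. cls v = cls u) = cls u"
    by (rule someI) (rule HOL.refl)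
  then show ?thesis
    unfolding exp_hom_def by (intro exp_sum_pres_eq) (simp add: cls_def pres_class_eq_iff)
qed

lemma exp_hom_mult:
  "\<lbrakk>g \<in> carrier FG; h \<in> carrier FG\<rbrakk> \<Longrightarrow> exp_hom x (g \<otimes>\<^bsub>FG\<^esub> h) = exp_hom x g + exp_hom x h"
  by (auto simp: carrier_FG cls_mult exp_hom_cls exp_sum_def)

lemma exp_hom_one: "exp_hom x \<one>\<^bsub>FG\<^esub> = 0"
  using exp_hom_mult[of "\<one>\<^bsub>FG\<^esub>" "\<one>\<^bsub>FG\<^esub>" x] by simp

lemma exp_hom_pow:
  assumes g: "g \<in> carrier FG"
  shows "exp_hom x (g [^]\<^bsub>FG\<^esub> (k::int)) = k * exp_hom x g"
proof -
  have nat: "exp_hom x (g [^]\<^bsub>FG\<^esub> (n::nat)) = int n * exp_hom x g" for n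
    using g by (induction n) (simp_all add: exp_hom_one exp_hom_mult algebra_simps)
  have inv: "exp_hom x (inv\<^bsub>FG\<^esub> h) = - exp_hom x h" if "h \<in> carrier FG" for h
    using exp_hom_mult[of "inv\<^bsub>FG\<^esub> h" h x] that exp_hom_one[of x] by simp
  show ?thesis
  proof (cases "k < 0")
    case True
    have "exp_hom x (g [^]\<^bsub>FG\<^esub> k) = - exp_hom x (g [^]\<^bsub>FG\<^esub> nat (- k))"
      using inv[of "g [^]\<^bsub>FG\<^esub> nat (- k)"] g True by (simp only: int_pow_def2 if_True FG.nat_pow_closed)
    then show ?thesis
      using nat[of "nat (- k)"] True by simp
  next
    case False
    then have "exp_hom x (g [^]\<^bsub>FG\<^esub> k) = exp_hom x (g [^]\<^bsub>FG\<^esub> nat k)"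
      by (simp only: int_pow_def2 if_False)
    then show ?thesis
      using nat[of "nat k"] False by simp
  qed
qed

section \<open>The plane spanned by a and b\<close>

definition plane_pt :: "int \<times> int \<Rightarrow> tab group_word set" where
  "plane_pt v = syl_val (Syl_AB (fst v) (snd v))"

lemma plane_pt_carrier [simp]: "plane_pt v \<in> carrier FG"
  by (simp add: plane_pt_def del: syl_val.simps)

lemma plane_pt_add: "plane_pt (v + w) = plane_pt v \<otimes>\<^bsub>FG\<^esub> plane_pt w"
  unfolding plane_pt_def by (subst syl_val_add[symmetric]) simp_all

lemma plane_pt_minus: "plane_pt (- v) = inv\<^bsub>FG\<^esub> (plane_pt v)"
proof -
  have "plane_pt 0 = \<one>\<^bsub>FG\<^esub>"
    by (simp add: plane_pt_def)
  then have "plane_pt (- v) \<otimes>\<^bsub>FG\<^esub> plane_pt v = \<one>\<^bsub>FG\<^esub>"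
    by (simp flip: plane_pt_add)
  then show ?thesis
    by (intro FG.inv_equality[symmetric]) simp_all
qed

text \<open>With \<open>additive_le_word_length\<close> this bounds the word length on the plane
  below by a multiple of each coordinate.\<close>

lemma exp_hom_plane_pt: "exp_hom A (plane_pt v) = fst v" "exp_hom B (plane_pt v) = snd v"
  by (simp_all add: plane_pt_def exp_hom_mult exp_hom_pow exp_hom_cls exp_sum_def)

lemma FG_not_hyperbolic: "\<not> hyperbolic_group FG"
proof
  assume "hyperbolic_group FG"
  then obtain S \<delta> where S: "symmetric_generating_set FG S"
    and hyp: "\<And>x y z w. \<lbrakk>x \<in> carrier FG; y \<in> carrier FG; z \<in> carrier FG; w \<in> carrier FG\<rbrakk>
      \<Longrightarrow> min (gromov_product FG S x z w) (gromov_product FG S y z w) - \<delta> \<le> gromov_product FG S x y w"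
    unfolding hyperbolic_group_def by blast
  define N where "N v = real (word_length FG S (plane_pt v))" for v
  have dist: "word_dist FG S (plane_pt v) (plane_pt w) = N (- w + v)" for v w
    by (simp only: word_dist_def N_def plane_pt_add plane_pt_minus)
  have even: "N (- v) = N v" for v
    by (simp add: N_def plane_pt_minus FG.word_length_inv[OF S])
  \<comment> \<open>The summand 1 guarantees that \<open>C\<close> is positive, so that
    \<open>1 / C\<close> can serve as the slope of the lower bound.\<close>
  define C where "C = 1 + (\<Sum>s\<in>S. \<bar>exp_hom A s\<bar> + \<bar>exp_hom B s\<bar>)"
  have "finite S"
    using S by (simp add: symmetric_generating_set_def)
  then have "\<bar>exp_hom A s\<bar> + \<bar>exp_hom B s\<bar> \<le> (\<Sum>s\<in>S. \<bar>exp_hom A s\<bar> + \<bar>exp_hom B s\<bar>)" if "s \<in> S" for s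
    using that by (intro member_le_sum) auto
  then have C: "\<bar>exp_hom A s\<bar> \<le> C" "\<bar>exp_hom B s\<bar> \<le> C" if "s \<in> S" for s
    using that unfolding C_def by (smt (verit))+
  have "0 < C"
    unfolding C_def by (smt (verit) sum_nonneg)
  have le: "1 / C * \<bar>real_of_int i\<bar> \<le> N v" if "\<bar>i\<bar> \<le> C * int (word_length FG S (plane_pt v))" for i v
    using of_int_le_iff[where ?'a = real, THEN iffD2, OF that] \<open>0 < C\<close> by (simp add: N_def field_simps)
  show False
  proof (rule plane_not_hyperbolic[of N "2 * \<delta>" "1 / C"])
    show "N (- v) = N v" for v by (rule even)
    show "N (v + w) \<le> N v + N w" for v w
      using FG.word_length_mult[OF S, of "plane_pt v" "plane_pt w"] by (simp add: N_def plane_pt_add)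
    show "N (v + w) + N (v - w) \<le> 2 * max (N v) (N w) + 2 * \<delta>" for v w
    proof -
      have gp: "gromov_product FG S (plane_pt p) (plane_pt q) (plane_pt 0) = (N p + N q - N (p - q)) / 2"
        for p q
        by (simp add: gromov_product_def dist even)
      have "v - (v + w) = - w" "w - (v + w) = - v"
        by simp_all
      \<comment> \<open>The base point is 0 and \<open>v + w\<close> the intermediate point. The
        minimum is \<open>(N (v + w) - \<bar>N v - N w\<bar>) / 2\<close>, and
        \<open>N v + N w + \<bar>N v - N w\<bar>\<close> is twice the maximum of \<open>N v\<close>
        and \<open>N w\<close>.\<close>
      then have "min ((N v + N (v + w) - N w) / 2) ((N w + N (v + w) - N v) / 2) - \<delta>
          \<le> (N v + N w - N (v - w)) / 2"
        using hyp[of "plane_pt v" "plane_pt w" "plane_pt (v + w)" "plane_pt 0"] by (simp only: gp even plane_pt_carrier)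
      then show ?thesis
        by (cases "N v \<le> N w") (simp_all add: max_def min_def field_simps split: if_splits)
    qed
    show "1 / C * real_of_int \<bar>fst v\<bar> \<le> N v" for v
      using le[of "fst v" v] FG.additive_le_word_length[OF S _ exp_hom_mult C(1), of "plane_pt v"]
      by (simp add: exp_hom_plane_pt)
    show "1 / C * real_of_int \<bar>snd v\<bar> \<le> N v" for v
      using le[of "snd v" v] FG.additive_le_word_length[OF S _ exp_hom_mult C(2), of "plane_pt v"]
      by (simp add: exp_hom_plane_pt)
    show "0 < 1 / real_of_int C" using \<open>0 < C\<close> by simp
  qed
qed

theorem theorem3:
  "\<not> hyperbolic_group Z_free_prod_Z2 \<and>
   (\<exists>S. symmetric_generating_set Z_free_prod_Z2 S \<and>
        (\<forall>g \<in> carrier Z_free_prod_Z2 - {\<one>\<^bsub>Z_free_prod_Z2\<^esub>}. conj_curvature Z_free_prod_Z2 S g < 0))"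
  using FG_not_hyperbolic generating_gens conj_curvature_gens_neg by blast

end
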